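(* Let $(X,\to,0,1)$ be an involutive BE algebra. Then the following hold for all $x,y,z\in X$: (1) $x\le_Q z$, $y\le_Q z$ and $z\to x=z\to y$ imply $x=y$; (2) $(x\to (y\to z))\to x^*=((y\to z)\Cap x)^*$; (3) $x\to ((y\to x^* )^*\Cup z)=y\Cup (x\to z)$; (4) $((y\to x)\Cap z)\to x=y\Cup (z\to x)$; (5) $x\le_Q y$ implies $(y\to x)\odot y=x$; (6) $x\to (z\odot y^* )=((z\to y)\odot x)^*$; (7) $(x\Cup y)\Cap y=y$ and $(x\Cap y)\Cup y=y$.
   Context: A BE algebra is an algebra $(X,\to,1)$ of type $(2,0)$ such that for all $x,y,z\in X$: $x\to x=1$; $x\to 1=1$; $1\to x=x$; $x\to(y\to z)=y\to(x\to z)$. Put $x\le y$ iff $x\to y=1$. It is bounded if there is $0\in X$ with $0\le x$ for all $x\in X$; then $x^*:=x\to 0$. It is involutive if it is bounded and $x^{**}=x$ for all $x$. In an involutive BE algebra $(X,\to,0,1)$ define $x\Cup y:=(x\to y)\to y$, $x\Cap y:=((x^*\to y^* )\to y^* )^*$, $x\odot y:=(x\to y^* )^*$, and $x\le_Q y$ iff $x=x\Cap y$. *)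

theory Defs
  imports Main
begin

class be_algebra = one +
  fixes be_imp :: "'a \<Rightarrow> 'a \<Rightarrow> 'a"  (infixr "\<rightarrow>" 60)
  assumes be_imp_self: "x \<rightarrow> x = 1"
    and be_imp_one: "x \<rightarrow> 1 = 1"
    and be_one_imp: "1 \<rightarrow> x = x"
    and be_exchange: "x \<rightarrow> (y \<rightarrow> z) = y \<rightarrow> (x \<rightarrow> z)"
begin

text \<open>In a general BE algebra this relation need not be antisymmetric (nor transitive),
  so it is not made an instance of the order classes.\<close>

definition be_le :: "'a \<Rightarrow> 'a \<Rightarrow> bool"  (infix "\<sqsubseteq>" 50)
  where "x \<sqsubseteq> y \<longleftrightarrow> x \<rightarrow> y = 1"

end

text \<open>Since \<open>\<sqsubseteq>\<close> need not be antisymmetric, its least element need not be unique;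
  the bottom element is therefore part of the structure.\<close>

class bounded_be_algebra = be_algebra + zero +
  assumes be_zero_least: "0 \<sqsubseteq> x"
begin

definition be_neg :: "'a \<Rightarrow> 'a"  ("_\<^sup>\<star>" [1000] 1000)
  where "x\<^sup>\<star> = x \<rightarrow> 0"

end

class involutive_be_algebra = bounded_be_algebra +
  assumes be_neg_neg: "x\<^sup>\<star>\<^sup>\<star> = x"
begin

text \<open>The double cup and double cap of the paper; they are not commutative in general,
  hence not lattice operations despite the notation.\<close>

definition be_cup :: "'a \<Rightarrow> 'a \<Rightarrow> 'a"  (infixl "\<squnion>" 65)
  where "x \<squnion> y = (x \<rightarrow> y) \<rightarrow> y"

definition be_cap :: "'a \<Rightarrow> 'a \<Rightarrow> 'a"  (infixl "\<sqinter>" 70)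
  where "x \<sqinter> y = ((x\<^sup>\<star> \<rightarrow> y\<^sup>\<star>) \<rightarrow> y\<^sup>\<star>)\<^sup>\<star>"

definition be_odot :: "'a \<Rightarrow> 'a \<Rightarrow> 'a"  (infixl "\<odot>" 70)
  where "x \<odot> y = (x \<rightarrow> y\<^sup>\<star>)\<^sup>\<star>"

definition be_leQ :: "'a \<Rightarrow> 'a \<Rightarrow> bool"  (infix "\<le>\<^sub>Q" 50)
  where "x \<le>\<^sub>Q y \<longleftrightarrow> x = x \<sqinter> y"

end

end

theory Submission
  imports Defs
begin

text \<open>The involution makes \<open>\<odot>\<close> behave like the product of a residuated structure, even
  though \<open>\<sqsubseteq>\<close> need not be an order. The exchange law, applied to an implication into \<open>0\<close>, is
  contraposition (\<open>be_contrapos\<close>), and contraposition followed by exchange is currying,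
  \<open>(x \<odot> y) \<rightarrow> z = x \<rightarrow> (y \<rightarrow> z)\<close> (\<open>be_odot_imp\<close>). The operation \<open>\<sqinter>\<close>, in turn, is the divisibility
  term \<open>(y \<rightarrow> x) \<odot> y\<close> (\<open>be_cap_conv_odot\<close>).

  Hence \<open>x \<le>\<^sub>Q y\<close> means \<open>x = (y \<rightarrow> x) \<odot> y\<close>, so that \<open>x\<close> is recovered from \<open>y\<close> and
  \<open>y \<rightarrow> x\<close>: this is the cancellation law and its companion identity. The identities
  with \<open>\<sqinter>\<close> or \<open>\<squnion>\<close> inside an implication hold because currying and exchange reduce both sides
  to the same iterated implication; those about negations are exchange with \<open>0\<close>; and in the
  absorption laws currying or exchange exposes a subterm \<open>y \<rightarrow> y = 1\<close>.\<close>

lemma be_imp_neg_commute: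
  fixes x y :: "'a::involutive_be_algebra"
  shows "x \<rightarrow> y\<^sup>\<star> = y \<rightarrow> x\<^sup>\<star>"
  unfolding be_neg_def by (rule be_exchange)

lemma be_contrapos:
  fixes x y :: "'a::involutive_be_algebra"
  shows "y\<^sup>\<star> \<rightarrow> x\<^sup>\<star> = x \<rightarrow> y"
  using be_imp_neg_commute[of x "y\<^sup>\<star>"] by (simp add: be_neg_neg)

text \<open>Contraposition makes the negated premise \<open>x \<odot> y\<close> the conclusion \<open>x \<rightarrow> y\<^sup>\<star>\<close>; exchange then
  brings \<open>x\<close> to the front, and a second contraposition restores \<open>y \<rightarrow> z\<close>.\<close>

lemma be_odot_imp:
  fixes x y z :: "'a::involutive_be_algebra"
  shows "(x \<odot> y) \<rightarrow> z = x \<rightarrow> (y \<rightarrow> z)"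
proof -
  have "(x \<odot> y) \<rightarrow> z = z\<^sup>\<star> \<rightarrow> (x \<rightarrow> y\<^sup>\<star>)"
    using be_contrapos[of z "x \<odot> y"] by (simp add: be_odot_def be_neg_neg)
  also have "\<dots> = x \<rightarrow> (z\<^sup>\<star> \<rightarrow> y\<^sup>\<star>)"
    by (rule be_exchange)
  finally show ?thesis
    by (simp add: be_contrapos)
qed

lemma be_neg_odot:
  fixes x y :: "'a::involutive_be_algebra"
  shows "(x \<odot> y)\<^sup>\<star> = x \<rightarrow> y\<^sup>\<star>"
  by (simp add: be_odot_def be_neg_neg)

lemma be_one_odot:
  fixes x :: "'a::involutive_be_algebra"
  shows "1 \<odot> x = x"
  by (simp add: be_odot_def be_one_imp be_neg_neg)

lemma be_cap_conv_odot:
  fixes x y :: "'a::involutive_be_algebra"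
  shows "x \<sqinter> y = (y \<rightarrow> x) \<odot> y"
  by (simp add: be_cap_def be_odot_def be_contrapos)

lemma be_leQ_conv_odot:
  fixes x y :: "'a::involutive_be_algebra"
  shows "x \<le>\<^sub>Q y \<longleftrightarrow> (y \<rightarrow> x) \<odot> y = x"
  by (auto simp: be_leQ_def be_cap_conv_odot)

lemma be_imp_cup:
  fixes x y z :: "'a::involutive_be_algebra"
  shows "x \<rightarrow> ((y \<odot> x) \<squnion> z) = y \<squnion> (x \<rightarrow> z)"
  by (simp add: be_cup_def be_odot_imp be_exchange[of x "y \<rightarrow> (x \<rightarrow> z)"])

lemma be_cap_imp:
  fixes x y z :: "'a::involutive_be_algebra"
  shows "((y \<rightarrow> x) \<sqinter> z) \<rightarrow> x = y \<squnion> (z \<rightarrow> x)"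
  by (simp add: be_cup_def be_cap_conv_odot be_odot_imp be_exchange[of z y])

text \<open>Both absorption laws hold because the factor in front of \<open>y\<close> collapses to \<open>1\<close>: exchange
  turns \<open>y \<rightarrow> (x \<squnion> y)\<close> into \<open>(x \<rightarrow> y) \<rightarrow> (y \<rightarrow> y)\<close>, and currying turns \<open>(x \<sqinter> y) \<rightarrow> y\<close> into
  \<open>(y \<rightarrow> x) \<rightarrow> (y \<rightarrow> y)\<close>.\<close>

lemma be_cup_cap_absorb:
  fixes x y :: "'a::involutive_be_algebra"
  shows "(x \<squnion> y) \<sqinter> y = y"
proof -
  have "y \<rightarrow> (x \<squnion> y) = 1"
    by (simp add: be_cup_def be_exchange[of y "x \<rightarrow> y"] be_imp_self be_imp_one)
  then show ?thesis
    by (simp add: be_cap_conv_odot be_one_odot)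
qed

lemma be_cap_cup_absorb:
  fixes x y :: "'a::involutive_be_algebra"
  shows "(x \<sqinter> y) \<squnion> y = y"
proof -
  have "(x \<sqinter> y) \<rightarrow> y = 1"
    by (simp add: be_cap_conv_odot be_odot_imp be_imp_self be_imp_one)
  then show ?thesis
    by (simp add: be_cup_def be_one_imp)
qed

theorem proposition2p3:
  fixes x y z :: "'a::involutive_be_algebra"
  shows "(x \<le>\<^sub>Q z \<and> y \<le>\<^sub>Q z \<and> z \<rightarrow> x = z \<rightarrow> y \<longrightarrow> x = y)
    \<and> (x \<rightarrow> (y \<rightarrow> z)) \<rightarrow> x\<^sup>\<star> = ((y \<rightarrow> z) \<sqinter> x)\<^sup>\<star>
    \<and> x \<rightarrow> ((y \<rightarrow> x\<^sup>\<star>)\<^sup>\<star> \<squnion> z) = y \<squnion> (x \<rightarrow> z)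
    \<and> ((y \<rightarrow> x) \<sqinter> z) \<rightarrow> x = y \<squnion> (z \<rightarrow> x)
    \<and> (x \<le>\<^sub>Q y \<longrightarrow> (y \<rightarrow> x) \<odot> y = x)
    \<and> x \<rightarrow> (z \<odot> y\<^sup>\<star>) = ((z \<rightarrow> y) \<odot> x)\<^sup>\<star>
    \<and> ((x \<squnion> y) \<sqinter> y = y \<and> (x \<sqinter> y) \<squnion> y = y)"
proof (intro conjI impI)
  assume "x \<le>\<^sub>Q z \<and> y \<le>\<^sub>Q z \<and> z \<rightarrow> x = z \<rightarrow> y"
  then show "x = y"
    by (metis be_leQ_conv_odot)
next
  show "(x \<rightarrow> (y \<rightarrow> z)) \<rightarrow> x\<^sup>\<star> = ((y \<rightarrow> z) \<sqinter> x)\<^sup>\<star>"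
    by (simp add: be_cap_conv_odot be_neg_odot)
next
  show "x \<rightarrow> ((y \<rightarrow> x\<^sup>\<star>)\<^sup>\<star> \<squnion> z) = y \<squnion> (x \<rightarrow> z)"
    using be_imp_cup[of x y z] by (simp add: be_odot_def)
next
  show "((y \<rightarrow> x) \<sqinter> z) \<rightarrow> x = y \<squnion> (z \<rightarrow> x)"
    by (rule be_cap_imp)
next
  assume "x \<le>\<^sub>Q y"
  then show "(y \<rightarrow> x) \<odot> y = x"
    by (simp add: be_leQ_conv_odot)
next
  \<comment> \<open>Here \<open>z \<odot> y\<^sup>\<star>\<close> is the negation of \<open>z \<rightarrow> y\<close>, so the sides are
    \<open>x \<rightarrow> (z \<rightarrow> y)\<^sup>\<star>\<close> and \<open>(z \<rightarrow> y) \<rightarrow> x\<^sup>\<star>\<close>.\<close>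
  show "x \<rightarrow> (z \<odot> y\<^sup>\<star>) = ((z \<rightarrow> y) \<odot> x)\<^sup>\<star>"
    using be_imp_neg_commute[of x "z \<rightarrow> y"]
    by (simp add: be_neg_odot) (simp add: be_odot_def be_neg_neg)
next
  show "(x \<squnion> y) \<sqinter> y = y"
    by (rule be_cup_cap_absorb)
next
  show "(x \<sqinter> y) \<squnion> y = y"
    by (rule be_cap_cup_absorb)
qed

end
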